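(* Let $0<\lambda<1$. The following hold. (a) Let $\nu\in\mathrm{Prob}(X)$, fix $(\bar c,\bar a)\in\mathcal{C}^{\mathbb{N}}\times\mathcal{I}^{\mathbb{N}}$, and define $\gamma:C^0(X\times\mathcal{C}\times\mathcal{I},\mathbb{R})\to\mathbb{R}$ by $$\gamma(g)=(1-\lambda)\int_X\sum_{i=0}^\infty\lambda^ig(x_i,c_i,a_i)\,d\nu(x),$$ where $x_0=x$ and $x_{i+1}=\tau_{a_i}(x_i)$. Then $\gamma\in\mathcal{H}^\lambda(\nu)$ (identifying $\gamma$ with a probability measure). In particular $\mathcal{H}^\lambda(\nu)$ is not empty. (b) For any trace $\nu\in\mathrm{Prob}(X)$, $m_\lambda(R)=(1-\lambda)\int v_\lambda(x)\,d\nu(x)$, where $v_\lambda$ is the (unique continuous) solution of the Bellman equation $0=\sup_{(c,a)\in\mathcal{C}\times\mathcal{I}}\left[A_c(\tau_a(x))+d_x^\lambda v_\lambda(a)\right]$, $x\in X$. (c) For any $z\in X$, the value of the problem for $\mathcal{H}^\lambda(\delta_z)$ is $m_\lambda(R)=(1-\lambda)v_\lambda(z)$. (d) For every $z\in X$, $$v_\lambda(z)=\inf_{w\in C^0(X,\mathbb{R})}\left[w(z)+\frac1{1-\lambda}\sup_{x\in X}h_w(x)\right],\qquad h_w(x)=\sup_{(c,a)\in\mathcal{C}\times\mathcal{I}}\left\{d_x^\lambda w(a)+A_c(\tau_a(x))\right\}.$$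
   Context: $(X,d)$ is a compact metric space, $\mathcal{C}$ and $\mathcal{I}$ are finite nonempty sets, $R=(X,\tau_a)_{a\in\mathcal{I}}$ is a contractive IFS (each $\tau_a:X\to X$ is a contraction), and $A_c:X\to\mathbb{R}$, $c\in\mathcal{C}$, are Lipschitz functions. For $w\in C^0(X,\mathbb{R})$ put $d_x^\lambda w(a)=\lambda w(\tau_a(x))-w(x)$. For $\nu\in\mathrm{Prob}(X)$, the set of discounted holonomic probabilities with discount $\lambda$ and trace $\nu$ is $$\mathcal{H}^\lambda(\nu)=\left\{\mu\in\mathrm{Prob}(X\times\mathcal{C}\times\mathcal{I}) : \int d_x^\lambda w(a)\,d\mu(x,c,a)=-(1-\lambda)\int w\,d\nu\ \ \forall w\in C^0(X,\mathbb{R})\right\},$$ and $m_\lambda(R)=\sup_{\mu\in\mathcal{H}^\lambda(\nu)}\int A_c(\tau_a(x))\,d\mu(x,c,a)$ (which depends on $\nu$). *)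

theory Defs
  imports "HOL-Probability.Probability"
begin

text \<open>
  The compact metric space \<open>X\<close> is a type of class \<open>metric_space\<close> whose universe is assumed
  compact. The finite nonempty sets of controls and of map indices are types of class
  \<open>{finite, discrete_topology}\<close>; with the discrete topology on these two factors, continuity
  and Borel measurability on \<open>X \<times> C \<times> I\<close> are those of the product topology on
  \<open>'x \<times> 'c \<times> 'i\<close>. The discount factor is written \<open>l\<close>.
\<close>

definition C0 :: "('a::topological_space \<Rightarrow> real) set" where
  "C0 = {f. continuous_on UNIV f}"

definition Prob :: "'a::topological_space measure set" where
  "Prob = {M. prob_space M \<and> sets M = sets borel}"

definition contraction :: "('x::metric_space \<Rightarrow> 'x) \<Rightarrow> bool" where
  "contraction f \<longleftrightarrow> (\<exists>k<1. k-lipschitz_on UNIV f)"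

definition disc_diff ::
    "real \<Rightarrow> ('i \<Rightarrow> 'x \<Rightarrow> 'x) \<Rightarrow> ('x \<Rightarrow> real) \<Rightarrow> 'x \<Rightarrow> 'i \<Rightarrow> real" where
  "disc_diff l \<tau> w x a = l * w (\<tau> a x) - w x"

definition holonomic ::
    "real \<Rightarrow> ('i::{finite,discrete_topology} \<Rightarrow> 'x::metric_space \<Rightarrow> 'x) \<Rightarrow> 'x measure
      \<Rightarrow> ('x \<times> 'c::{finite,discrete_topology} \<times> 'i) measure set" where
  "holonomic l \<tau> \<nu> = {\<mu> \<in> Prob. \<forall>w \<in> C0.
     (\<integral>(x, c, a). disc_diff l \<tau> w x a \<partial>\<mu>) = - (1 - l) * (\<integral>x. w x \<partial>\<nu>)}"

definition payoff ::
    "('i \<Rightarrow> 'x \<Rightarrow> 'x) \<Rightarrow> ('c \<Rightarrow> 'x \<Rightarrow> real) \<Rightarrow> ('x \<times> 'c \<times> 'i) measure \<Rightarrow> real" where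
  "payoff \<tau> A \<mu> = (\<integral>(x, c, a). A c (\<tau> a x) \<partial>\<mu>)"

definition holonomic_value ::
    "real \<Rightarrow> ('i::{finite,discrete_topology} \<Rightarrow> 'x::metric_space \<Rightarrow> 'x)
      \<Rightarrow> ('c::{finite,discrete_topology} \<Rightarrow> 'x \<Rightarrow> real) \<Rightarrow> 'x measure \<Rightarrow> real" where
  "holonomic_value l \<tau> A \<nu> = (SUP \<mu> \<in> holonomic l \<tau> \<nu>. payoff \<tau> A \<mu>)"

primrec orbit :: "('i \<Rightarrow> 'x \<Rightarrow> 'x) \<Rightarrow> (nat \<Rightarrow> 'i) \<Rightarrow> 'x \<Rightarrow> nat \<Rightarrow> 'x" where
  "orbit \<tau> as x 0 = x"
| "orbit \<tau> as x (Suc i) = \<tau> (as i) (orbit \<tau> as x i)"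

definition orbit_functional ::
    "real \<Rightarrow> ('i \<Rightarrow> 'x \<Rightarrow> 'x) \<Rightarrow> 'x measure \<Rightarrow> (nat \<Rightarrow> 'c) \<Rightarrow> (nat \<Rightarrow> 'i)
      \<Rightarrow> ('x \<times> 'c \<times> 'i \<Rightarrow> real) \<Rightarrow> real" where
  "orbit_functional l \<tau> \<nu> cs as g =
     (1 - l) * (\<integral>x. (\<Sum>i. l ^ i * g (orbit \<tau> as x i, cs i, as i)) \<partial>\<nu>)"

text \<open>The identification, as in the Riesz representation theorem, of functionals on the
  continuous functions with Borel probability measures.\<close>

definition represents ::
    "'a::topological_space measure \<Rightarrow> (('a \<Rightarrow> real) \<Rightarrow> real) \<Rightarrow> bool" where
  "represents \<mu> \<gamma> \<longleftrightarrow> \<mu> \<in> Prob \<and> (\<forall>g \<in> C0. \<gamma> g = (\<integral>p. g p \<partial>\<mu>))"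

definition bellman_rhs ::
    "real \<Rightarrow> ('i::finite \<Rightarrow> 'x \<Rightarrow> 'x) \<Rightarrow> ('c::finite \<Rightarrow> 'x \<Rightarrow> real) \<Rightarrow> ('x \<Rightarrow> real) \<Rightarrow> 'x \<Rightarrow> real"
  where
  "bellman_rhs l \<tau> A w x = (SUP (c, a) \<in> UNIV. A c (\<tau> a x) + disc_diff l \<tau> w x a)"

definition bellman_solution ::
    "real \<Rightarrow> ('i::finite \<Rightarrow> 'x::metric_space \<Rightarrow> 'x) \<Rightarrow> ('c::finite \<Rightarrow> 'x \<Rightarrow> real)
      \<Rightarrow> ('x \<Rightarrow> real) \<Rightarrow> bool" where
  "bellman_solution l \<tau> A v \<longleftrightarrow> v \<in> C0 \<and> (\<forall>x. 0 = bellman_rhs l \<tau> A v x)"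

text \<open>Existence and uniqueness of this solution are part of the theorem's conclusion.\<close>

definition value_function ::
    "real \<Rightarrow> ('i::finite \<Rightarrow> 'x::metric_space \<Rightarrow> 'x) \<Rightarrow> ('c::finite \<Rightarrow> 'x \<Rightarrow> real)
      \<Rightarrow> 'x \<Rightarrow> real" where
  "value_function l \<tau> A = (THE v. bellman_solution l \<tau> A v)"

text \<open>The function \<open>h\<^sub>w\<close> is \<open>bellman_rhs l \<tau> A w\<close>.\<close>

definition dual_objective ::
    "real \<Rightarrow> ('i::finite \<Rightarrow> 'x \<Rightarrow> 'x) \<Rightarrow> ('c::finite \<Rightarrow> 'x \<Rightarrow> real) \<Rightarrow> 'x \<Rightarrow> ('x \<Rightarrow> real) \<Rightarrow> real"
  where
  "dual_objective l \<tau> A z w = w z + 1 / (1 - l) * (SUP x. bellman_rhs l \<tau> A w x)"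

end

theory Submission
  imports Defs
begin

text \<open>
  Let \<open>x 0 = x, x 1, x 2, \<dots>\<close> be a trajectory in which \<open>x (i+1)\<close> is the image of \<open>x i\<close> under the map
  chosen at time \<open>i\<close>. If \<open>x\<close> is distributed according to \<open>\<nu>\<close> and time is weighted by
  \<open>(1 - l) l ^ i\<close>, the resulting law of (point, control, map index), the discounted occupation
  measure of the trajectory, is holonomic with trace \<open>\<nu>\<close>, because the discounted sum of
  \<open>l w (x (i+1)) - w (x i)\<close> telescopes (\<open>occupation_holonomic\<close>). Applied to fixed sequences of
  controls and maps this represents the orbit functional. The representing measure is unique since
  continuous functions determine a Borel probability (\<open>Prob_eqI_C0\<close>).

  The Bellman equation is the fixed point equation of an operator that contracts the supremum
  distance, so Banach's theorem gives its unique continuous solution \<open>v\<close>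
  (\<open>bellman_solution_ex1\<close>).

  The two problems are dual linear programs. Integrating \<open>A\<^sub>c (\<tau>\<^sub>a x) + d w x a \<le> h\<^sub>w x \<le> sup h\<^sub>w\<close>
  against a holonomic \<open>\<mu>\<close> bounds the payoff of \<open>\<mu>\<close> by \<open>(1 - l) \<integral>w d\<nu> + sup h\<^sub>w\<close>
  (\<open>payoff_le\<close>). For \<open>w = v\<close> one has \<open>h\<^sub>v = 0\<close>, and the bound is attained by the occupation measure
  of a feedback policy that always picks a maximiser in the Bellman equation
  (\<open>optimal_holonomic_exists\<close>). Hence the primal value is \<open>(1 - l) \<integral>v d\<nu>\<close>. For \<open>\<nu> = \<delta>\<^sub>z\<close> the same
  inequality, read with \<open>w\<close> arbitrary and \<open>\<mu>\<close> optimal, says that \<open>v z\<close> is a lower bound of the dual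
  objective; equality holds at \<open>w = v\<close>.
\<close>

section \<open>Suprema over finite types\<close>

lemma SUP_finite_eq_iff:
  fixes f :: "'k::finite \<Rightarrow> real"
  shows "(SUP k. f k) = m \<longleftrightarrow> (\<forall>k. f k \<le> m) \<and> (\<exists>k. f k = m)"
proof -
  have "(SUP k. f k) = Max (range f)"
    by (intro cSup_eq_Max) auto
  moreover have "Max (range f) = m \<longleftrightarrow> (\<forall>k. f k \<le> m) \<and> (\<exists>k. f k = m)"
    by (subst Max_eq_iff) auto
  ultimately show ?thesis by simp
qed

lemma SUP_finite_upper: "f k \<le> (SUP k. f k)" for f :: "'k::finite \<Rightarrow> real"
  using SUP_finite_eq_iff[of f "SUP k. f k"] by auto

lemma SUP_finite_attained: "\<exists>k. f k = (SUP k. f k)" for f :: "'k::finite \<Rightarrow> real"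
  using SUP_finite_eq_iff[of f "SUP k. f k"] by auto

lemma continuous_on_SUP_finite:
  fixes f :: "'k::finite \<Rightarrow> 'a::topological_space \<Rightarrow> real"
  assumes "\<And>k. continuous_on S (f k)"
  shows "continuous_on S (\<lambda>x. SUP k. f k x)"
proof -
  have "continuous_on S (\<lambda>x. SUP k\<in>K. f k x)" if "finite K" "K \<noteq> {}" for K
    using that
  proof (induction K rule: finite_ne_induct)
    case (insert k K)
    have "(SUP j\<in>insert k K. f j x) = max (f k x) (SUP j\<in>K. f j x)" for x
      using insert.hyps by (subst cSUP_insert) (auto simp: sup_max)
    then show ?case
      using insert.IH assms by (auto intro!: continuous_on_max)
  qed (use assms in auto)
  then show ?thesis by auto
qed

text \<open>
  A finite family of measurable functions admits a measurable choice of a maximising index: going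
  through the indices one at a time, a new index replaces the current choice on the measurable
  set where it does at least as well.
\<close>

lemma measurable_argmax:
  fixes f :: "'k::finite \<Rightarrow> 'a \<Rightarrow> real"
  assumes f: "\<And>k. f k \<in> borel_measurable M"
  obtains s where "s \<in> M \<rightarrow>\<^sub>M count_space UNIV" "\<And>x. f (s x) x = (SUP k. f k x)"
proof -
  have "\<exists>s. s \<in> M \<rightarrow>\<^sub>M count_space UNIV \<and> (\<forall>x. \<forall>k\<in>K. f k x \<le> f (s x) x)"
    if "finite K" "K \<noteq> {}" for K :: "'k set"
    using that
  proof (induction K rule: finite_ne_induct)
    case (singleton k)
    show ?case by (rule exI[of _ "\<lambda>_. k"]) auto
  next
    case (insert k K)
    then obtain s where s[measurable]: "s \<in> M \<rightarrow>\<^sub>M count_space UNIV"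
      and smax: "\<And>x j. j \<in> K \<Longrightarrow> f j x \<le> f (s x) x" by blast
    note f[measurable]
    have [measurable]: "(\<lambda>x. f (s x) x) \<in> borel_measurable M"
      by (rule measurable_compose_countable[OF _ s]) (rule f)
    let ?t = "\<lambda>x. if f (s x) x \<le> f k x then k else s x"
    have "?t \<in> M \<rightarrow>\<^sub>M count_space UNIV" by measurable
    moreover have "f j x \<le> f (?t x) x" if "j \<in> insert k K" for j x
      using that smax[of j x] by auto
    ultimately show ?case by blast
  qed
  from this[of UNIV] obtain s where s: "s \<in> M \<rightarrow>\<^sub>M count_space UNIV"
    and smax: "\<And>x k. f k x \<le> f (s x) x" by auto
  have "f (s x) x = (SUP k. f k x)" for x
    using SUP_finite_eq_iff[of "\<lambda>k. f k x" "f (s x) x"] smax by auto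
  with s show ?thesis by (rule that)
qed

section \<open>Continuous functions and Borel probabilities\<close>

lemma C0_iff: "f \<in> C0 \<longleftrightarrow> continuous_on UNIV f"
  by (simp add: C0_def)

text \<open>The fibre over each \<open>(c, a)\<close> is an open copy of the first factor.\<close>

lemma continuous_on_discrete_fibres:
  fixes f :: "'x::topological_space \<times> 'c::discrete_topology \<times> 'i::discrete_topology
    \<Rightarrow> 'b::topological_space"
  assumes "\<And>c a. continuous_on UNIV (\<lambda>x. f (x, c, a))"
  shows "continuous_on UNIV f"
proof (subst continuous_on_open_vimage[OF open_UNIV], intro allI impI)
  fix B :: "'b set" assume "open B"
  have "open ((\<lambda>x. f (x, c, a)) -` B \<times> {c} \<times> {a})" for c a
    using open_vimage[OF \<open>open B\<close> assms] by (intro open_Times discrete_topology_class.open_discrete)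
  then have "open (\<Union>c a. (\<lambda>x. f (x, c, a)) -` B \<times> {c} \<times> {a})" by blast
  also have "(\<Union>c a. (\<lambda>x. f (x, c, a)) -` B \<times> {c} \<times> {a}) = f -` B \<inter> UNIV" by auto
  finally show "open (f -` B \<inter> UNIV)" .
qed

lemma C0_bounded:
  fixes f :: "'a::topological_space \<Rightarrow> real"
  assumes "compact (UNIV :: 'a set)" "f \<in> C0"
  obtains B where "\<And>x. \<bar>f x\<bar> \<le> B"
  using compact_imp_bounded[OF compact_continuous_image[of UNIV f]] assms
  by (auto simp: C0_iff bounded_iff)

lemma compact_UNIV_discrete_fibres:
  assumes "compact (UNIV :: 'x::topological_space set)"
  shows "compact (UNIV :: ('x \<times> 'c::{finite,topological_space} \<times> 'i::{finite,topological_space}) set)"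
proof -
  have "compact ((UNIV :: 'x set) \<times> (UNIV :: 'c set) \<times> (UNIV :: 'i set))"
    by (intro compact_Times assms finite_imp_compact) auto
  then show ?thesis by simp
qed

lemma ProbD:
  assumes "M \<in> Prob"
  shows "prob_space M" "sets M = sets borel" "space M = UNIV"
  using assms sets_eq_imp_space_eq[of M borel] by (auto simp: Prob_def)

lemma return_Prob: "return borel z \<in> Prob"
  by (auto simp: Prob_def intro!: prob_space_return)

lemma integral_return_C0: "w \<in> C0 \<Longrightarrow> (\<integral>x. w x \<partial>return borel z) = w z" for w :: "'a::topological_space \<Rightarrow> real"
  by (intro integral_return) (auto simp: C0_iff intro!: borel_measurable_continuous_onI)

lemma Prob_integrable:
  fixes f :: "'a::topological_space \<Rightarrow> real"
  assumes "M \<in> Prob" "f \<in> borel_measurable borel" "\<And>x. \<bar>f x\<bar> \<le> B"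
  shows "integrable M f"
proof -
  interpret prob_space M using assms(1) by (rule ProbD)
  show ?thesis
    using assms ProbD(2)[OF assms(1)]
    by (intro integrable_const_bound[of _ B]) (auto cong: measurable_cong_sets)
qed

lemma C0_integrable:
  fixes f :: "'a::topological_space \<Rightarrow> real"
  assumes "compact (UNIV :: 'a set)" "M \<in> Prob" "f \<in> C0"
  shows "integrable M f"
proof -
  obtain B where "\<And>x. \<bar>f x\<bar> \<le> B" using C0_bounded assms by blast
  then show ?thesis
    using assms by (intro Prob_integrable) (auto simp: C0_iff borel_measurable_continuous_onI)
qed

text \<open>
  When every open set is the positivity set \<open>{f > 0}\<close> of a continuous \<open>f \<ge> 0\<close>, its indicator is
  the increasing limit of the continuous functions \<open>min 1 (n f)\<close>, so that the integrals of
  continuous functions determine the probability of open sets, and these generate the Borel sets.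
\<close>

lemma Prob_eqI_C0:
  fixes M N :: "'a::topological_space measure"
  assumes MN: "M \<in> Prob" "N \<in> Prob"
    and pos: "\<And>U :: 'a set. open U \<Longrightarrow> \<exists>f\<in>C0. (\<forall>x. f x \<ge> 0) \<and> U = {x. f x > (0::real)}"
    and eq: "\<And>g. g \<in> C0 \<Longrightarrow> (\<integral>x. g x \<partial>M) = (\<integral>x. g x \<partial>N)"
  shows "M = N"
proof (rule measure_eqI_generator_eq[where E = "{U. open U}" and \<Omega> = UNIV and A = "\<lambda>_. UNIV"])
  fix U :: "'a set" assume "U \<in> {U. open U}"
  then have "open U" by simp
  from pos[OF this] obtain f where f: "f \<in> C0" "\<And>x. f x \<ge> 0" "U = {x. f x > 0}" by blast
  define g where "g n x = min 1 (real n * f x)" for n x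
  have g: "g n \<in> C0" for n
    using f(1) unfolding g_def C0_iff by (intro continuous_intros)
  have lim: "(\<lambda>n. g n x) \<longlonglongrightarrow> indicator U x" for x
  proof (cases "x \<in> U")
    case True
    then have "f x > 0" using f by simp
    then obtain n0 where n0: "1 \<le> real n0 * f x"
      using reals_Archimedean3[of "f x"] less_imp_le by blast
    have "g n x = 1" if "n \<ge> n0" for n
    proof -
      have "real n0 * f x \<le> real n * f x"
        using that \<open>f x > 0\<close> by (intro mult_right_mono) auto
      then show ?thesis using n0 by (auto simp: g_def)
    qed
    then have "eventually (\<lambda>n. g n x = 1) sequentially"
      by (auto simp: eventually_sequentially)
    then show ?thesis using True by (simp add: tendsto_eventually)
  next
    case False
    then have "f x = 0" using f(2)[of x] f(3) by auto
    then show ?thesis using False by (simp add: g_def)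
  qed
  have "(\<lambda>n. \<integral>x. g n x \<partial>L) \<longlonglongrightarrow> measure L U" if L: "L \<in> Prob" for L
  proof -
    interpret L: prob_space L using L by (rule ProbD)
    note [measurable_cong] = ProbD(2)[OF L]
    have [measurable]: "g n \<in> borel_measurable borel" for n
      using g[of n] unfolding C0_iff by (rule borel_measurable_continuous_onI)
    have [measurable]: "U \<in> sets borel" using \<open>open U\<close> by (rule borel_open)
    have "(\<lambda>n. \<integral>x. g n x \<partial>L) \<longlonglongrightarrow> (\<integral>x. indicator U x \<partial>L)"
    proof (rule integral_dominated_convergence)
      show "integrable L (\<lambda>_. 1 :: real)" by simp
      show "AE x in L. (\<lambda>n. g n x) \<longlonglongrightarrow> indicator U x" using lim by simp
      show "AE x in L. norm (g n x) \<le> 1" for n using f(2) by (simp add: g_def)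
    qed measurable
    then show ?thesis using ProbD[OF L] by simp
  qed
  from this[OF MN(1)] this[OF MN(2)] have "measure M U = measure N U"
    using eq[OF g] by (auto intro: LIMSEQ_unique)
  then show "emeasure M U = emeasure N U"
    using MN[THEN ProbD(1)]
    by (simp add: finite_measure.emeasure_eq_measure prob_space.finite_measure)
next
  interpret M: prob_space M using MN(1) by (rule ProbD)
  show "emeasure M UNIV \<noteq> \<infinity>" for n :: nat by simp
qed (use MN[THEN ProbD(2)] in \<open>auto simp: Int_stable_def sets_borel\<close>)

text \<open>On each fibre the required function is the distance to the complement of the open set.\<close>

lemma open_eq_positivity_set:
  fixes U :: "('x::metric_space \<times> 'c::discrete_topology \<times> 'i::discrete_topology) set"
  assumes "open U"
  shows "\<exists>f\<in>C0. (\<forall>p. f p \<ge> 0) \<and> U = {p. f p > (0::real)}"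
proof -
  define F where "F c a = {x. (x, c, a) \<notin> U}" for c a
  \<comment> \<open>The distance to the empty set is 0 by convention, hence the case distinction.\<close>
  define f where "f = (\<lambda>(x, c, a). if F c a = {} then 1 else infdist x (F c a))"
  have "closed (F c a)" for c a
  proof -
    have "open ((\<lambda>x. (x, c, a)) -` U)"
      by (intro open_vimage assms continuous_intros)
    moreover have "- F c a = (\<lambda>x. (x, c, a)) -` U" by (auto simp: F_def)
    ultimately show ?thesis by (simp add: closed_def)
  qed
  then have "x \<in> F c a \<longleftrightarrow> infdist x (F c a) = 0" if "F c a \<noteq> {}" for x c a
    using that by (rule in_closed_iff_infdist_zero)
  then have "x \<notin> F c a \<longleftrightarrow> f (x, c, a) > 0" for x c a
    using infdist_nonneg[of x "F c a"] by (cases "F c a = {}") (auto simp: f_def less_le)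
  then have "(x, c, a) \<in> U \<longleftrightarrow> f (x, c, a) > 0" for x c a
    by (simp add: F_def)
  moreover have "continuous_on UNIV (\<lambda>x. f (x, c, a))" for c a
    by (cases "F c a = {}") (auto simp: f_def intro!: continuous_intros)
  then have "f \<in> C0" unfolding C0_iff by (rule continuous_on_discrete_fibres)
  moreover have "f p \<ge> 0" for p
    by (simp add: f_def infdist_nonneg split: prod.split)
  moreover have "U = {p. f p > 0}"
    using calculation(1) by auto
  ultimately show ?thesis by (intro bexI[of _ f] conjI allI)
qed

lemma represents_unique:
  fixes \<mu> \<mu>' :: "('x::metric_space \<times> 'c::discrete_topology \<times> 'i::discrete_topology) measure"
  assumes "represents \<mu> \<gamma>" "represents \<mu>' \<gamma>"
  shows "\<mu>' = \<mu>"
proof (rule Prob_eqI_C0)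
  show "(\<integral>p. g p \<partial>\<mu>') = (\<integral>p. g p \<partial>\<mu>)" if "g \<in> C0" for g
    using assms that unfolding represents_def by metis
qed (use assms open_eq_positivity_set in \<open>simp_all add: represents_def\<close>)

section \<open>Discounted occupation measures\<close>

text \<open>
  The law of \<open>\<phi> i x\<close> when \<open>x\<close> is drawn from \<open>\<nu>\<close> and, independently, the time \<open>i\<close> from the
  geometric distribution with weights \<open>(1 - l) l ^ i\<close>.
\<close>

definition occupation ::
    "real \<Rightarrow> 'x measure \<Rightarrow> (nat \<Rightarrow> 'x \<Rightarrow> 'b) \<Rightarrow> 'b::topological_space measure" where
  "occupation l \<nu> \<phi> = distr (measure_pmf (geometric_pmf (1 - l)) \<Otimes>\<^sub>M \<nu>) borel (\<lambda>(i, x). \<phi> i x)"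

context
  fixes l :: real and \<nu> :: "'x::topological_space measure"
    and \<phi> :: "nat \<Rightarrow> 'x \<Rightarrow> 'b::topological_space"
  assumes l: "0 < l" "l < 1" and \<nu>: "\<nu> \<in> Prob"
    and \<phi>: "\<And>i. \<phi> i \<in> borel \<rightarrow>\<^sub>M borel"
begin

interpretation prob_space \<nu> using \<nu> by (rule ProbD)
interpretation pair_prob_space "measure_pmf (geometric_pmf (1 - l))" \<nu> ..

lemma measurable_trajectory:
  "(\<lambda>(i, x). \<phi> i x) \<in> measure_pmf (geometric_pmf (1 - l)) \<Otimes>\<^sub>M \<nu> \<rightarrow>\<^sub>M borel"
proof -
  have [measurable]: "\<phi> i \<in> \<nu> \<rightarrow>\<^sub>M borel" for i
    using \<phi>[of i] ProbD(2)[OF \<nu>] by (simp cong: measurable_cong_sets)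
  have "(\<lambda>p. \<phi> (fst p) (snd p)) \<in> measure_pmf (geometric_pmf (1 - l)) \<Otimes>\<^sub>M \<nu> \<rightarrow>\<^sub>M borel"
    by (rule measurable_compose_countable[where g = fst]) measurable
  then show ?thesis by (simp add: case_prod_beta')
qed

lemma occupation_Prob: "occupation l \<nu> \<phi> \<in> Prob"
  using measurable_trajectory by (auto simp: Prob_def occupation_def intro!: prob_space_distr)

lemma integral_occupation:
  fixes g :: "'b \<Rightarrow> real"
  assumes g: "g \<in> borel_measurable borel" and B: "\<And>p. \<bar>g p\<bar> \<le> B"
  shows "(\<integral>p. g p \<partial>occupation l \<nu> \<phi>) = (1 - l) * (\<integral>x. (\<Sum>i. l ^ i * g (\<phi> i x)) \<partial>\<nu>)"
proof -
  let ?G = "measure_pmf (geometric_pmf (1 - l))"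
  have summ: "summable (\<lambda>i. \<bar>l ^ i * g (\<phi> i x)\<bar>)" for x
  proof (rule summable_comparison_test'[where N = 0])
    show "summable (\<lambda>i. l ^ i * B)"
      using l by (intro summable_mult2 summable_geometric) auto
    show "norm \<bar>l ^ i * g (\<phi> i x)\<bar> \<le> l ^ i * B" for i
      using B[of "\<phi> i x"] l by (auto simp: abs_mult intro!: mult_left_mono)
  qed
  have time: "(\<integral>i. g (\<phi> i x) \<partial>?G) = (1 - l) * (\<Sum>i. l ^ i * g (\<phi> i x))" for x
  proof -
    have "(\<integral>i. g (\<phi> i x) \<partial>?G) = (\<integral>i. (1 - l) * (l ^ i * g (\<phi> i x)) \<partial>count_space UNIV)"
      unfolding measure_pmf_eq_density using l
      by (subst integral_density) (auto simp: mult_ac)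
    also have "\<dots> = (1 - l) * (\<integral>i. l ^ i * g (\<phi> i x) \<partial>count_space UNIV)" by simp
    also have "\<dots> = (1 - l) * (\<Sum>i. l ^ i * g (\<phi> i x))"
      using summ[of x] by (subst integral_count_space_nat) (auto simp: integrable_count_space_nat_iff)
    finally show ?thesis .
  qed
  have "(\<lambda>p. g (case p of (i, x) \<Rightarrow> \<phi> i x)) \<in> borel_measurable (?G \<Otimes>\<^sub>M \<nu>)"
    using measurable_compose[OF measurable_trajectory g] .
  then have int: "integrable (?G \<Otimes>\<^sub>M \<nu>) (\<lambda>(i, x). g (\<phi> i x))"
    using B by (intro integrable_const_bound[of _ B]) (auto simp: case_prod_beta')
  have "(\<integral>p. g p \<partial>occupation l \<nu> \<phi>) = (\<integral>(i, x). g (\<phi> i x) \<partial>(?G \<Otimes>\<^sub>M \<nu>))"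
    unfolding occupation_def by (subst integral_distr[OF measurable_trajectory g])
      (simp add: case_prod_beta')
  also have "\<dots> = (\<integral>x. (\<integral>i. g (\<phi> i x) \<partial>?G) \<partial>\<nu>)"
    using integral_snd[OF int] by simp
  finally show ?thesis by (simp add: time)
qed

end

text \<open>
  Along a controlled trajectory \<open>x 0, x 1, \<dots>\<close> the discounted sum of \<open>l w (x (i+1)) - w (x i)\<close>
  telescopes to \<open>- w (x 0)\<close>; this is exactly what makes the occupation measure holonomic.
\<close>

lemma occupation_holonomic:
  fixes \<tau> :: "'i::{finite,discrete_topology} \<Rightarrow> 'x::metric_space \<Rightarrow> 'x"
    and \<phi> :: "nat \<Rightarrow> 'x \<Rightarrow> 'x \<times> 'c::{finite,discrete_topology} \<times> 'i"
  assumes X: "compact (UNIV :: 'x set)" and \<tau>: "\<And>a. continuous_on UNIV (\<tau> a)"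
    and l: "0 < l" "l < 1" and \<nu>: "\<nu> \<in> Prob" and \<phi>: "\<And>i. \<phi> i \<in> borel \<rightarrow>\<^sub>M borel"
    and start: "\<And>x. fst (\<phi> 0 x) = x"
    and step: "\<And>i x. fst (\<phi> (Suc i) x) = \<tau> (snd (snd (\<phi> i x))) (fst (\<phi> i x))"
  shows "occupation l \<nu> \<phi> \<in> holonomic l \<tau> \<nu>"
proof -
  have "(\<integral>(x, c, a). disc_diff l \<tau> w x a \<partial>occupation l \<nu> \<phi>) = - (1 - l) * (\<integral>x. w x \<partial>\<nu>)"
    if w: "w \<in> C0" for w
  proof -
    let ?g = "\<lambda>(x, c :: 'c, a). disc_diff l \<tau> w x a"
    have "?g \<in> C0"
      using w unfolding C0_iff disc_diff_def
      by (intro continuous_on_discrete_fibres)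
        (auto intro!: continuous_intros continuous_on_compose2[OF _ \<tau>])
    moreover obtain B where "\<And>p. \<bar>?g p\<bar> \<le> B"
      using C0_bounded[OF compact_UNIV_discrete_fibres[OF X] calculation] by blast
    ultimately have "(\<integral>p. ?g p \<partial>occupation l \<nu> \<phi>) =
        (1 - l) * (\<integral>x. (\<Sum>i. l ^ i * ?g (\<phi> i x)) \<partial>\<nu>)"
      by (intro integral_occupation[OF l \<nu> \<phi>])
        (auto simp: C0_iff intro!: borel_measurable_continuous_onI)
    also have "(\<lambda>x. \<Sum>i. l ^ i * ?g (\<phi> i x)) = (\<lambda>x. - w x)"
    proof
      fix x
      let ?u = "\<lambda>i. l ^ i * w (fst (\<phi> i x))"
      obtain D where D: "\<And>y. \<bar>w y\<bar> \<le> D" using C0_bounded[OF X w] by blast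
      have "(\<lambda>i. l ^ i * D) \<longlonglongrightarrow> 0 * D"
        using l by (intro tendsto_mult LIMSEQ_realpow_zero tendsto_const) auto
      moreover have "norm (?u i) \<le> l ^ i * D" for i
        using D[of "fst (\<phi> i x)"] l by (auto simp: abs_mult intro!: mult_left_mono)
      ultimately have "?u \<longlonglongrightarrow> 0"
        by (intro Lim_null_comparison[of ?u]) auto
      then have "(\<lambda>i. ?u (Suc i) - ?u i) sums (0 - ?u 0)" by (rule telescope_sums)
      moreover have "?u (Suc i) - ?u i = l ^ i * ?g (\<phi> i x)" for i
        by (simp add: step disc_diff_def case_prod_beta' algebra_simps)
      ultimately show "(\<Sum>i. l ^ i * ?g (\<phi> i x)) = - w x"
        by (simp add: sums_iff start)
    qed
    finally show ?thesis by (simp add: algebra_simps)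
  qed
  then show ?thesis
    using occupation_Prob[OF l \<nu> \<phi>] by (auto simp: holonomic_def)
qed

lemma orbit_functional_represented:
  fixes \<tau> :: "'i::{finite,discrete_topology} \<Rightarrow> 'x::metric_space \<Rightarrow> 'x"
    and cs :: "nat \<Rightarrow> 'c::{finite,discrete_topology}"
  assumes X: "compact (UNIV :: 'x set)" and \<tau>: "\<And>a. continuous_on UNIV (\<tau> a)"
    and l: "0 < l" "l < 1" and \<nu>: "\<nu> \<in> Prob"
  shows "\<exists>\<mu>\<in>holonomic l \<tau> \<nu>. represents \<mu> (orbit_functional l \<tau> \<nu> cs as)"
proof -
  define \<phi> where "\<phi> i x = (orbit \<tau> as x i, cs i, as i)" for i x
  have "continuous_on UNIV (\<lambda>x. orbit \<tau> as x i)" for i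
    by (induction i) (auto intro!: continuous_intros continuous_on_compose2[OF \<tau>])
  then have \<phi>: "\<phi> i \<in> borel \<rightarrow>\<^sub>M borel" for i
    unfolding \<phi>_def by (intro borel_measurable_continuous_onI continuous_intros) auto
  have "occupation l \<nu> \<phi> \<in> holonomic l \<tau> \<nu>"
    by (rule occupation_holonomic[OF X \<tau> l \<nu> \<phi>]) (auto simp: \<phi>_def)
  moreover have "represents (occupation l \<nu> \<phi>) (orbit_functional l \<tau> \<nu> cs as)"
    unfolding represents_def
  proof (intro conjI ballI)
    fix g :: "'x \<times> 'c \<times> 'i \<Rightarrow> real" assume g: "g \<in> C0"
    then obtain B where "\<And>p. \<bar>g p\<bar> \<le> B"
      using C0_bounded[OF compact_UNIV_discrete_fibres[OF X]] by blast
    with g show "orbit_functional l \<tau> \<nu> cs as g = (\<integral>p. g p \<partial>occupation l \<nu> \<phi>)"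
      unfolding orbit_functional_def
      by (subst integral_occupation[OF l \<nu> \<phi>])
        (auto simp: \<phi>_def C0_iff intro!: borel_measurable_continuous_onI)
  qed (rule occupation_Prob[OF l \<nu> \<phi>])
  ultimately show ?thesis by blast
qed

section \<open>The Bellman equation\<close>

lemma continuous_bellman_rhs:
  fixes \<tau> :: "'i::finite \<Rightarrow> 'x::metric_space \<Rightarrow> 'x" and A :: "'c::finite \<Rightarrow> 'x \<Rightarrow> real"
  assumes \<tau>: "\<And>a. continuous_on UNIV (\<tau> a)" and A: "\<And>c. continuous_on UNIV (A c)"
    and w: "w \<in> C0"
  shows "bellman_rhs l \<tau> A w \<in> C0"
proof -
  have "continuous_on UNIV (\<lambda>x. case k of (c, a) \<Rightarrow> A c (\<tau> a x) + disc_diff l \<tau> w x a)" for k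
    using w unfolding C0_iff disc_diff_def
    by (cases k) (auto intro!: continuous_intros continuous_on_compose2[OF _ \<tau>] A)
  then show ?thesis
    unfolding C0_iff bellman_rhs_def by (rule continuous_on_SUP_finite)
qed

text \<open>
  The solutions are the fixed points of the dynamic programming operator
  \<open>w \<mapsto> max\<^sub>c\<^sub>,\<^sub>a (A\<^sub>c + l w) \<circ> \<tau>\<^sub>a\<close>, which contracts the supremum distance by the factor \<open>l\<close>.
\<close>

lemma bellman_solution_ex1:
  fixes \<tau> :: "'i::finite \<Rightarrow> 'x::metric_space \<Rightarrow> 'x" and A :: "'c::finite \<Rightarrow> 'x \<Rightarrow> real"
  assumes X: "compact (UNIV :: 'x set)"
    and \<tau>: "\<And>a. continuous_on UNIV (\<tau> a)" and A: "\<And>c. continuous_on UNIV (A c)"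
    and l: "0 < l" "l < 1"
  shows "\<exists>!v. bellman_solution l \<tau> A v"
proof -
  define T where "T w x = (SUP k. A (fst k) (\<tau> (snd k) x) + l * w (\<tau> (snd k) x))" for w x
  have sol_iff: "bellman_solution l \<tau> A v \<longleftrightarrow> v \<in> C0 \<and> (\<forall>x. T v x = v x)" for v
  proof -
    have "0 = bellman_rhs l \<tau> A v x \<longleftrightarrow> T v x = v x" for x
      unfolding bellman_rhs_def T_def eq_commute[of 0] SUP_finite_eq_iff disc_diff_def
      by (auto simp: algebra_simps)
    then show ?thesis by (simp add: bellman_solution_def)
  qed
  have bcont: "w \<in> bcontfun" if w: "w \<in> C0" for w :: "'x \<Rightarrow> real"
  proof -
    obtain B where "\<And>x. \<bar>w x\<bar> \<le> B" using C0_bounded[OF X w] by blast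
    then show ?thesis using w by (intro bcontfun_normI[of _ B]) (auto simp: C0_iff)
  qed
  have T_C0: "T w \<in> C0" if "w \<in> C0" for w
    using that unfolding C0_iff T_def
    by (intro continuous_on_SUP_finite)
      (auto intro!: continuous_intros continuous_on_compose2[OF _ \<tau>] A)
  define S where "S w = Bcontfun (T (apply_bcontfun w))" for w
  have S: "apply_bcontfun (S w) = T (apply_bcontfun w)" for w
    unfolding S_def by (intro Bcontfun_inverse bcont T_C0) (simp add: C0_iff)
  have T_le: "T (apply_bcontfun u) x \<le> T (apply_bcontfun v) x + l * dist u v" for u v x
  proof -
    obtain k where k: "A (fst k) (\<tau> (snd k) x) + l * apply_bcontfun u (\<tau> (snd k) x)
        = T (apply_bcontfun u) x"
      using SUP_finite_attained[of "\<lambda>k. A (fst k) (\<tau> (snd k) x) + l * apply_bcontfun u (\<tau> (snd k) x)"]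
      unfolding T_def by auto
    have "apply_bcontfun u (\<tau> (snd k) x) \<le> apply_bcontfun v (\<tau> (snd k) x) + dist u v"
      using dist_bounded[of u "\<tau> (snd k) x" v] by (simp add: dist_real_def)
    then have "l * apply_bcontfun u (\<tau> (snd k) x) \<le> l * apply_bcontfun v (\<tau> (snd k) x) + l * dist u v"
      using l by (simp flip: distrib_left)
    moreover have "A (fst k) (\<tau> (snd k) x) + l * apply_bcontfun v (\<tau> (snd k) x)
        \<le> T (apply_bcontfun v) x"
      unfolding T_def by (rule SUP_finite_upper)
    ultimately show ?thesis using k by simp
  qed
  have "dist (S u) (S v) \<le> l * dist u v" for u v
  proof (rule dist_bound)
    show "dist (apply_bcontfun (S u) x) (apply_bcontfun (S v) x) \<le> l * dist u v" for x
      using T_le[of u x v] T_le[of v x u] by (simp add: S dist_real_def dist_commute abs_le_iff)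
  qed
  then have fixpoint: "\<exists>!w. S w = w"
    using l by (intro banach_fix_type[of l]) auto
  then obtain w where w: "S w = w" by blast
  show ?thesis
  proof (rule ex1I)
    show "bellman_solution l \<tau> A (apply_bcontfun w)"
      using S[of w] w by (auto simp: sol_iff C0_iff)
    fix v assume v: "bellman_solution l \<tau> A v"
    then have v_inv: "apply_bcontfun (Bcontfun v) = v"
      by (intro Bcontfun_inverse bcont) (simp add: sol_iff)
    have "T v = v" using v by (auto simp: sol_iff)
    then have "S (Bcontfun v) = Bcontfun v" by (simp add: S_def v_inv)
    then have "Bcontfun v = w" using fixpoint w by blast
    then show "v = apply_bcontfun w" using v_inv by simp
  qed
qed

section \<open>Optimal holonomic measures and duality\<close>

context
  fixes \<tau> :: "'i::{finite,discrete_topology} \<Rightarrow> 'x::metric_space \<Rightarrow> 'x"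
    and A :: "'c::{finite,discrete_topology} \<Rightarrow> 'x \<Rightarrow> real" and l :: real
  assumes X: "compact (UNIV :: 'x set)"
    and \<tau>: "\<And>a. continuous_on UNIV (\<tau> a)" and A: "\<And>c. continuous_on UNIV (A c)"
    and l: "0 < l" "l < 1"
begin

lemma integral_bellman_integrand:
  fixes \<mu> :: "('x \<times> 'c \<times> 'i) measure"
  assumes \<mu>: "\<mu> \<in> holonomic l \<tau> \<nu>" and w: "w \<in> C0"
  shows "integrable \<mu> (\<lambda>(x, c, a). A c (\<tau> a x) + disc_diff l \<tau> w x a)"
    and "(\<integral>(x, c, a). A c (\<tau> a x) + disc_diff l \<tau> w x a \<partial>\<mu>) =
      payoff \<tau> A \<mu> - (1 - l) * (\<integral>x. w x \<partial>\<nu>)"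
proof -
  have P: "\<mu> \<in> Prob" using \<mu> by (simp add: holonomic_def)
  note integrable = C0_integrable[OF compact_UNIV_discrete_fibres[OF X] P]
  have i1: "integrable \<mu> (\<lambda>(x, c, a). A c (\<tau> a x))"
    by (intro integrable, unfold C0_iff, intro continuous_on_discrete_fibres)
      (auto intro!: continuous_on_compose2[OF A \<tau>])
  have i2: "integrable \<mu> (\<lambda>(x, c, a). disc_diff l \<tau> w x a)"
    using w by (intro integrable, unfold C0_iff disc_diff_def, intro continuous_on_discrete_fibres)
      (auto intro!: continuous_intros continuous_on_compose2[OF _ \<tau>])
  show "integrable \<mu> (\<lambda>(x, c, a). A c (\<tau> a x) + disc_diff l \<tau> w x a)"
    using Bochner_Integration.integrable_add[OF i1 i2] by (simp add: case_prod_beta')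
  have "(\<integral>(x, c, a). A c (\<tau> a x) + disc_diff l \<tau> w x a \<partial>\<mu>) =
      payoff \<tau> A \<mu> + (\<integral>(x, c, a). disc_diff l \<tau> w x a \<partial>\<mu>)"
    using Bochner_Integration.integral_add[OF i1 i2] by (simp add: case_prod_beta' payoff_def)
  then show "(\<integral>(x, c, a). A c (\<tau> a x) + disc_diff l \<tau> w x a \<partial>\<mu>) =
      payoff \<tau> A \<mu> - (1 - l) * (\<integral>x. w x \<partial>\<nu>)"
    using \<mu> w by (auto simp: holonomic_def algebra_simps)
qed

text \<open>
  Weak duality: the constraint removes the dependence on \<open>\<mu>\<close> of the integral of \<open>d w\<close>, and a
  probability integrates the remaining integrand to at most its upper bound.
\<close>

lemma payoff_le:
  fixes \<mu> :: "('x \<times> 'c \<times> 'i) measure"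
  assumes \<mu>: "\<mu> \<in> holonomic l \<tau> \<nu>" and w: "w \<in> C0"
    and le: "\<And>x. bellman_rhs l \<tau> A w x \<le> m"
  shows "payoff \<tau> A \<mu> \<le> (1 - l) * (\<integral>x. w x \<partial>\<nu>) + m"
proof -
  have P: "\<mu> \<in> Prob" using \<mu> by (simp add: holonomic_def)
  interpret prob_space \<mu> using P by (rule ProbD)
  have "A c (\<tau> a x) + disc_diff l \<tau> w x a \<le> m" for x c a
    using SUP_finite_upper[of "\<lambda>(c, a). A c (\<tau> a x) + disc_diff l \<tau> w x a" "(c, a)"] le[of x]
    by (simp add: bellman_rhs_def)
  then have "(\<integral>(x, c, a). A c (\<tau> a x) + disc_diff l \<tau> w x a \<partial>\<mu>) \<le> (\<integral>p. m \<partial>\<mu>)"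
    by (intro integral_mono integral_bellman_integrand[OF \<mu> w]) auto
  then show ?thesis
    using integral_bellman_integrand(2)[OF \<mu> w] by (simp add: prob_space)
qed

text \<open>
  Equality is reached by the occupation measure of the feedback policy that uses at each point a
  maximiser in the Bellman equation: the integrand \<open>A\<^sub>c \<circ> \<tau>\<^sub>a + d v\<close> vanishes all along its
  trajectories. Maximisers can in general not be selected continuously, which is why the
  trajectories \<open>\<phi>\<close> of an occupation measure are only required to be Borel in \<open>x\<close>.
\<close>

lemma optimal_holonomic_exists:
  assumes v: "bellman_solution l \<tau> A v" and \<nu>: "\<nu> \<in> Prob"
  shows "\<exists>\<mu> \<in> holonomic l \<tau> \<nu>. payoff \<tau> A \<mu> = (1 - l) * (\<integral>x. v x \<partial>\<nu>)"
proof -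
  have vC: "v \<in> C0" and v0: "\<And>x. bellman_rhs l \<tau> A v x = 0"
    using v by (auto simp: bellman_solution_def)
  let ?q = "\<lambda>k x. case k of (c, a) \<Rightarrow> A c (\<tau> a x) + disc_diff l \<tau> v x a"
  have "?q k \<in> borel_measurable borel" for k
    using vC unfolding C0_iff disc_diff_def
    by (cases k) (auto intro!: borel_measurable_continuous_onI continuous_intros
        continuous_on_compose2[OF _ \<tau>] A)
  then obtain s where s: "s \<in> (borel :: 'x measure) \<rightarrow>\<^sub>M count_space UNIV"
    and max: "\<And>x. ?q (s x) x = (SUP k. ?q k x)"
    using measurable_argmax[of ?q borel] by blast
  have opt: "?q (s x) x = 0" for x
    using max[of x] v0[of x] by (simp add: bellman_rhs_def)
  define F where "F x = \<tau> (snd (s x)) x" for x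
  define \<phi> where "\<phi> i x = ((F ^^ i) x, s ((F ^^ i) x))" for i x
  have F: "F \<in> borel \<rightarrow>\<^sub>M borel"
    unfolding F_def
    by (rule measurable_compose_countable[of "\<lambda>k. \<tau> (snd k)", OF _ s])
      (rule borel_measurable_continuous_onI[OF \<tau>])
  have Fi: "F ^^ i \<in> borel \<rightarrow>\<^sub>M borel" for i
    by (induction i) (auto simp: id_def intro: measurable_compose[OF _ F])
  have "(\<lambda>x. (x, s x)) \<in> borel \<rightarrow>\<^sub>M borel"
    by (rule measurable_compose_countable[of "\<lambda>k x. (x, k)", OF _ s])
      (intro borel_measurable_continuous_onI continuous_intros)
  then have \<phi>: "\<phi> i \<in> borel \<rightarrow>\<^sub>M borel" for i
    unfolding \<phi>_def by (rule measurable_compose[OF Fi])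
  have hol: "occupation l \<nu> \<phi> \<in> holonomic l \<tau> \<nu>"
    by (rule occupation_holonomic[OF X \<tau> l \<nu> \<phi>]) (auto simp: \<phi>_def F_def)
  let ?g = "\<lambda>(x, c, a). A c (\<tau> a x) + disc_diff l \<tau> v x a"
  have "?g \<in> C0"
    using vC unfolding C0_iff disc_diff_def
    by (intro continuous_on_discrete_fibres)
      (auto intro!: continuous_intros continuous_on_compose2[OF _ \<tau>] A)
  moreover obtain B where "\<And>p. \<bar>?g p\<bar> \<le> B"
    using C0_bounded[OF compact_UNIV_discrete_fibres[OF X] calculation] by blast
  ultimately have "(\<integral>p. ?g p \<partial>occupation l \<nu> \<phi>) =
      (1 - l) * (\<integral>x. (\<Sum>i. l ^ i * ?g (\<phi> i x)) \<partial>\<nu>)"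
    by (intro integral_occupation[OF l \<nu> \<phi>])
      (auto simp: C0_iff intro!: borel_measurable_continuous_onI)
  also have "(\<lambda>x. \<Sum>i. l ^ i * ?g (\<phi> i x)) = (\<lambda>x. 0)"
    using opt by (simp add: \<phi>_def)
  finally have "payoff \<tau> A (occupation l \<nu> \<phi>) = (1 - l) * (\<integral>x. v x \<partial>\<nu>)"
    using integral_bellman_integrand(2)[OF hol vC] by simp
  with hol show ?thesis by blast
qed

lemma holonomic_value_eq:
  assumes v: "bellman_solution l \<tau> A v" and \<nu>: "\<nu> \<in> Prob"
  shows "bdd_above (payoff \<tau> A ` holonomic l \<tau> \<nu>)"
    and "holonomic_value l \<tau> A \<nu> = (1 - l) * (\<integral>x. v x \<partial>\<nu>)"
proof -
  have le: "payoff \<tau> A \<mu> \<le> (1 - l) * (\<integral>x. v x \<partial>\<nu>)" if "\<mu> \<in> holonomic l \<tau> \<nu>" for \<mu>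
    using payoff_le[OF that, of v 0] v by (simp add: bellman_solution_def)
  then show "bdd_above (payoff \<tau> A ` holonomic l \<tau> \<nu>)" by (rule bdd_aboveI2)
  obtain \<mu> where "\<mu> \<in> holonomic l \<tau> \<nu>" "payoff \<tau> A \<mu> = (1 - l) * (\<integral>x. v x \<partial>\<nu>)"
    using optimal_holonomic_exists[OF v \<nu>] by blast
  with le show "holonomic_value l \<tau> A \<nu> = (1 - l) * (\<integral>x. v x \<partial>\<nu>)"
    unfolding holonomic_value_def
    by (intro cSup_eq_maximum) (auto simp: image_iff intro: bexI[of _ \<mu>])
qed

text \<open>
  Here weak duality is applied to a measure that is optimal for \<open>\<delta>\<^sub>z\<close>, whose payoff is
  \<open>(1 - l) v z\<close>.
\<close>

lemma bellman_solution_le_dual_objective: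
  assumes v: "bellman_solution l \<tau> A v" and w: "w \<in> C0"
  shows "v z \<le> dual_objective l \<tau> A z w"
proof -
  let ?m = "SUP x. bellman_rhs l \<tau> A w x"
  obtain B where B: "\<And>x. \<bar>bellman_rhs l \<tau> A w x\<bar> \<le> B"
    using C0_bounded[OF X continuous_bellman_rhs[where \<tau> = \<tau> and A = A, OF \<tau> A w]] by blast
  have "bellman_rhs l \<tau> A w x \<le> B" for x using B[of x] by simp
  then have "bdd_above (range (bellman_rhs l \<tau> A w))" by (rule bdd_aboveI2)
  then have le: "bellman_rhs l \<tau> A w x \<le> ?m" for x by (rule cSUP_upper[OF UNIV_I])
  have "v \<in> C0" using v by (simp add: bellman_solution_def)
  moreover obtain \<mu> where "\<mu> \<in> holonomic l \<tau> (return borel z)"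
      "payoff \<tau> A \<mu> = (1 - l) * (\<integral>x. v x \<partial>return borel z)"
    using optimal_holonomic_exists[OF v return_Prob] by blast
  ultimately have "(1 - l) * v z \<le> (1 - l) * w z + ?m"
    using payoff_le[where \<nu> = "return borel z", OF _ w le] by (metis integral_return_C0 w)
  then show ?thesis using l by (simp add: dual_objective_def field_simps)
qed

lemma bellman_solution_eq_INF_dual_objective:
  assumes v: "bellman_solution l \<tau> A v"
  shows "bdd_below (dual_objective l \<tau> A z ` C0)"
    and "v z = (INF w\<in>C0. dual_objective l \<tau> A z w)"
proof -
  note le = bellman_solution_le_dual_objective[OF v]
  then show "bdd_below (dual_objective l \<tau> A z ` C0)" by (rule bdd_belowI2)
  have "dual_objective l \<tau> A z v = v z" "v \<in> C0"
    using v by (auto simp: dual_objective_def bellman_solution_def simp flip: fun_eq_iff)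
  then show "v z = (INF w\<in>C0. dual_objective l \<tau> A z w)"
    using le by (intro cInf_eq_minimum[symmetric]) (auto simp: image_iff intro!: bexI[of _ v])
qed

end

section \<open>The value of the discounted holonomic problem\<close>

theorem theorem3p2:
  fixes \<tau> :: "'i::{finite,discrete_topology} \<Rightarrow> 'x::metric_space \<Rightarrow> 'x"
    and A :: "'c::{finite,discrete_topology} \<Rightarrow> 'x \<Rightarrow> real"
    and l :: real
  assumes compact_X: "compact (UNIV :: 'x set)"
    and contractive: "\<And>a. contraction (\<tau> a)"
    and lipschitz: "\<And>c. \<exists>L. L-lipschitz_on UNIV (A c)"
    and discount: "0 < l" "l < 1"
  shows
    "(\<forall>\<nu> \<in> Prob.
        (\<forall>(cs :: nat \<Rightarrow> 'c) (as :: nat \<Rightarrow> 'i).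
           \<exists>\<mu> \<in> holonomic l \<tau> \<nu>. represents \<mu> (orbit_functional l \<tau> \<nu> cs as) \<and>
             (\<forall>\<mu>'. represents \<mu>' (orbit_functional l \<tau> \<nu> cs as) \<longrightarrow> \<mu>' = \<mu>)) \<and>
        (holonomic l \<tau> \<nu> :: ('x \<times> 'c \<times> 'i) measure set) \<noteq> {})
   \<and> (\<exists>!v. bellman_solution l \<tau> A v)
   \<and> (\<forall>\<nu> \<in> Prob.
        bdd_above (payoff \<tau> A ` holonomic l \<tau> \<nu>) \<and>
        holonomic_value l \<tau> A \<nu> = (1 - l) * (\<integral>x. value_function l \<tau> A x \<partial>\<nu>))
   \<and> (\<forall>z. holonomic_value l \<tau> A (return borel z) = (1 - l) * value_function l \<tau> A z)
   \<and> (\<forall>z. bdd_below (dual_objective l \<tau> A z ` C0) \<and>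
        value_function l \<tau> A z = (INF w \<in> C0. dual_objective l \<tau> A z w))"
proof -
  have \<tau>: "continuous_on UNIV (\<tau> a)" for a
    using contractive[of a] lipschitz_on_continuous_on by (auto simp: contraction_def)
  have A: "continuous_on UNIV (A c)" for c
    using lipschitz[of c] lipschitz_on_continuous_on by auto
  note orbits = orbit_functional_represented[where \<tau> = \<tau>, OF compact_X \<tau> discount]
  have ex1: "\<exists>!v. bellman_solution l \<tau> A v"
    by (rule bellman_solution_ex1[OF compact_X \<tau> A discount])
  then have v: "bellman_solution l \<tau> A (value_function l \<tau> A)"
    unfolding value_function_def by (rule theI')
  then have vC: "value_function l \<tau> A \<in> C0" by (simp add: bellman_solution_def)
  note primal = holonomic_value_eq[OF compact_X \<tau> A discount v]
  note dual = bellman_solution_eq_INF_dual_objective[OF compact_X \<tau> A discount v]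
  have "(holonomic l \<tau> \<nu> :: ('x \<times> 'c \<times> 'i) measure set) \<noteq> {}" if "\<nu> \<in> Prob" for \<nu>
    using orbits[OF that] by blast
  moreover have "\<exists>\<mu> \<in> holonomic l \<tau> \<nu>. represents \<mu> (orbit_functional l \<tau> \<nu> cs as) \<and>
      (\<forall>\<mu>'. represents \<mu>' (orbit_functional l \<tau> \<nu> cs as) \<longrightarrow> \<mu>' = \<mu>)"
    if "\<nu> \<in> Prob" for \<nu> and cs :: "nat \<Rightarrow> 'c" and as
    using orbits[OF that, of cs as] represents_unique by blast
  moreover have "holonomic_value l \<tau> A (return borel z) = (1 - l) * value_function l \<tau> A z" for z
    using primal(2)[OF return_Prob] integral_return_C0[OF vC] by metis
  ultimately show ?thesis
    using ex1 primal dual by (intro conjI allI ballI) auto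
qed

end
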